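(* For every constant $\epsilon>0$ there is a constant $c=c(\epsilon)>0$ such that the following holds. Let $G$ be a graph on the vertex set $\{1,\dots,n\}$ (with $n\ge 1$) with $m$ edges, maximum degree $\Delta$, and degree sequence $d_1,d_2,\dots,d_n$, where $d_i$ is the degree of vertex $i$. Suppose that for each $i\in\{1,\dots,n\}$ the subgraph of $G$ induced by the neighborhood of vertex $i$ contains at most $\epsilon d_i^{3/2}$ edges. Then $G$ has a bisection of size at least $$\frac m2+c\sum_{i=1}^n\sqrt{d_i}-2m\sqrt{\Delta/n}.$$
   Context: All graphs are finite and simple. A bisection of $G$ is a partition $V(G)=A\cup B$ with $A\cap B=\emptyset$ and $\big||A|-|B|\big|\le 1$; its size $e(A,B)$ is the number of edges with one end in $A$ and the other in $B$. *)

theory Defs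
  imports "HOL-Analysis.Analysis"
begin

text \<open>Finite simple graphs are given by a vertex set \<open>V\<close> and a set \<open>E\<close> of two-element
  subsets of \<open>V\<close>.\<close>

definition simple_graph :: "'a set \<Rightarrow> 'a set set \<Rightarrow> bool" where
  "simple_graph V E \<longleftrightarrow> finite V \<and> (\<forall>e\<in>E. e \<subseteq> V \<and> card e = 2)"

definition neighborhood :: "'a set set \<Rightarrow> 'a \<Rightarrow> 'a set" where
  "neighborhood E v = {u. {u, v} \<in> E}"

definition vertex_degree :: "'a set set \<Rightarrow> 'a \<Rightarrow> nat" where
  "vertex_degree E v = card (neighborhood E v)"

text \<open>Only meaningful for nonempty \<open>V\<close>.\<close>

definition max_degree :: "'a set \<Rightarrow> 'a set set \<Rightarrow> nat" where
  "max_degree V E = Max (vertex_degree E ` V)"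

definition induced_edges :: "'a set set \<Rightarrow> 'a set \<Rightarrow> 'a set set" where
  "induced_edges E S = {e \<in> E. e \<subseteq> S}"

definition cut_edges :: "'a set set \<Rightarrow> 'a set \<Rightarrow> 'a set \<Rightarrow> 'a set set" where
  "cut_edges E A B = {e \<in> E. \<exists>a\<in>A. \<exists>b\<in>B. e = {a, b}}"

text \<open>A part may be empty; this is unavoidable for a graph with a single vertex.\<close>

definition bisection :: "'a set \<Rightarrow> 'a set \<Rightarrow> 'a set \<Rightarrow> bool" where
  "bisection V A B \<longleftrightarrow>
     A \<union> B = V \<and> A \<inter> B = {} \<and> \<bar>int (card A) - int (card B)\<bar> \<le> 1"

end

(* Let h be uniformly random signs on the vertices, let s_i be the sum of h over the neighbors of i
   divided by sqrt d_i, and tilt h to y_i = (h_i - delta * clip s_i) / 2, where clip truncates to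
   [-2, 2]. For an edge ij the terms h_i * clip s_j and h_j * clip s_i make E[y_i y_j] negative, of
   total order - delta * sum_i sqrt d_i, by a fourth moment bound. The competing terms
   delta^2 * E[clip s_i * clip s_j] are at most delta^2 * codeg(i,j) / sqrt(d_i d_j), and their sum
   over the edges is controlled by the sparsity of the neighborhoods. The same codegree bound,
   summed over all pairs i, j, shows that the expected squared imbalance is at most Delta * n. The
   imbalance s is then removed by moving |s| / 2 vertices of small degree at a loss of at most
   2m|s|/n edges. Replacing |s| by the quadratic upper bound (s^2 + L^2) / (2L) with
   L = sqrt(Delta * n) makes the whole objective multilinear, so the fractional vector y can be
   rounded to signs one coordinate at a time. *)

theory Submission
  imports Defs
begin

section \<open>Uniformly random signs\<close>

definition sign_of :: "'a set \<Rightarrow> 'a \<Rightarrow> real" where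
  "sign_of S i = (if i \<in> S then -1 else 1)"

text \<open>Expectation over independent uniform signs on \<open>V\<close>, encoded as a finite
  mean: \<open>S\<close> is the set of vertices with sign -1, and every point outside
  \<open>V\<close> has sign 1.\<close>

definition avg :: "'a set \<Rightarrow> (('a \<Rightarrow> real) \<Rightarrow> real) \<Rightarrow> real" where
  "avg V f = (\<Sum>S\<in>Pow V. f (sign_of S)) / 2 ^ card V"

definition flip :: "'a set \<Rightarrow> ('a \<Rightarrow> real) \<Rightarrow> 'a \<Rightarrow> real" where
  "flip X h i = (if i \<in> X then - h i else h i)"

lemma sign_of_sq: "sign_of S i * sign_of S i = 1"
  by (simp add: sign_of_def)

lemma abs_sign_of: "\<bar>sign_of S i\<bar> = 1"
  by (simp add: sign_of_def)

lemma avg_add: "avg V (\<lambda>h. f h + g h) = avg V f + avg V g"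
  by (simp add: avg_def sum.distrib add_divide_distrib)

lemma avg_diff: "avg V (\<lambda>h. f h - g h) = avg V f - avg V g"
  by (simp add: avg_def sum_subtractf diff_divide_distrib)

lemma avg_cmult: "avg V (\<lambda>h. c * f h) = c * avg V f"
  by (simp add: avg_def sum_distrib_left)

lemma avg_sum: "avg V (\<lambda>h. \<Sum>i\<in>I. f i h) = (\<Sum>i\<in>I. avg V (f i))"
proof -
  have "(\<Sum>S\<in>Pow V. \<Sum>i\<in>I. f i (sign_of S)) = (\<Sum>i\<in>I. \<Sum>S\<in>Pow V. f i (sign_of S))"
    by (rule sum.swap)
  then show ?thesis by (simp add: avg_def sum_divide_distrib)
qed

lemma avg_const: "finite V \<Longrightarrow> avg V (\<lambda>h. c) = c"
  by (simp add: avg_def card_Pow)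

lemma avg_mono:
  assumes "\<And>S. f (sign_of S) \<le> g (sign_of S)"
  shows "avg V f \<le> avg V g"
  unfolding avg_def by (intro divide_right_mono sum_mono assms) simp

lemma avg_cong:
  assumes "\<And>S. f (sign_of S) = g (sign_of S)"
  shows "avg V f = avg V g"
  unfolding avg_def by (simp add: assms)

lemma ex_le_avg:
  assumes "finite V"
  shows "\<exists>S. f (sign_of S) \<le> avg V f"
proof (rule ccontr)
  assume "\<not> ?thesis"
  then have "(\<Sum>S\<in>Pow V. avg V f) < (\<Sum>S\<in>Pow V. f (sign_of S))"
    using assms by (intro sum_strict_mono) (auto simp: not_le)
  then show False
    using assms by (simp add: avg_def card_Pow)
qed

text \<open>Flipping the signs on \<open>X\<close> replaces \<open>S\<close> by its symmetric
  difference with \<open>X\<close>, which is an involution of \<open>Pow V\<close>.\<close>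

lemma avg_flip:
  assumes "X \<subseteq> V"
  shows "avg V (\<lambda>h. f (flip X h)) = avg V f"
proof -
  have "flip X (sign_of S) = sign_of (sym_diff S X)" for S
    by (auto simp: flip_def sign_of_def fun_eq_iff)
  moreover have "(\<Sum>S\<in>Pow V. f (sign_of (sym_diff S X))) = (\<Sum>S\<in>Pow V. f (sign_of S))"
    using assms
    by (intro sum.reindex_bij_witness[where i = "\<lambda>S. sym_diff S X" and j = "\<lambda>S. sym_diff S X"])
      (auto intro: arg_cong[where f = "\<lambda>S. f (sign_of S)"])
  ultimately show ?thesis by (simp add: avg_def)
qed

text \<open>Flipping the sign at \<open>k\<close> negates the integrand, so its average equals its
  own negative.\<close>

lemma avg_sign_mult_eq_0:
  assumes "k \<in> V" and "\<And>h. f (flip {k} h) = f h"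
  shows "avg V (\<lambda>h. h k * f h) = 0"
proof -
  have "avg V (\<lambda>h. h k * f h) = avg V (\<lambda>h. - 1 * (h k * f h))"
    using avg_flip[of "{k}" V "\<lambda>h. h k * f h"] assms by (simp add: flip_def)
  then show ?thesis by (simp only: avg_cmult)
qed

lemma sum_flip_disjoint:
  assumes "A \<inter> X = {}"
  shows "(\<Sum>i\<in>A. flip X h i) = (\<Sum>i\<in>A. h i)"
  using assms by (intro sum.cong) (auto simp: flip_def)

lemma sum_flip_subset:
  assumes "A \<subseteq> X"
  shows "(\<Sum>i\<in>A. flip X h i) = - (\<Sum>i\<in>A. h i)"
  unfolding sum_negf[symmetric] using assms by (intro sum.cong) (auto simp: flip_def)

text \<open>Induction adding one vertex \<open>k\<close>: expand the powers of
  \<open>h k + z\<close>, where \<open>z\<close> is independent of \<open>h k\<close>, so the terms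
  odd in \<open>h k\<close> average to 0. The fourth moment step uses the second moment, hence the
  joint induction.\<close>

lemma avg_sum_moments:
  assumes "finite V" "A \<subseteq> V"
  shows "avg V (\<lambda>h. (\<Sum>i\<in>A. h i)^2) = card A"
    and "avg V (\<lambda>h. (\<Sum>i\<in>A. h i)^4) \<le> 3 * (real (card A))^2"
proof -
  have "finite A" using assms finite_subset by blast
  then have "A \<subseteq> V \<longrightarrow> avg V (\<lambda>h. (\<Sum>i\<in>A. h i)^2) = card A \<and>
      avg V (\<lambda>h. (\<Sum>i\<in>A. h i)^4) \<le> 3 * (real (card A))^2"
  proof (induction A)
    case empty
    then show ?case using assms(1) by (simp add: avg_const)
  next
    case (insert k A)
    show ?case
    proof
      assume sub: "insert k A \<subseteq> V"
      let ?z = "\<lambda>h :: 'a \<Rightarrow> real. \<Sum>i\<in>A. h i"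
      have fl: "?z (flip {k} h) = ?z h" for h
        using insert.hyps by (intro sum_flip_disjoint) auto
      have odd: "avg V (\<lambda>h. h k * ?z h) = 0" "avg V (\<lambda>h. h k * ?z h ^ 3) = 0"
        using sub by (intro avg_sign_mult_eq_0; simp add: fl)+
      have IH: "avg V (\<lambda>h. ?z h^2) = card A" "avg V (\<lambda>h. ?z h^4) \<le> 3 * (real (card A))^2"
        using insert.IH sub by auto
      have "avg V (\<lambda>h. (\<Sum>i\<in>insert k A. h i)^2) = avg V (\<lambda>h. ?z h^2 + 2 * (h k * ?z h) + 1)"
        using insert.hyps sign_of_sq[of _ k]
        by (intro avg_cong) (simp add: power2_eq_square algebra_simps)
      also have "\<dots> = card (insert k A)"
        using insert.hyps assms(1) by (simp add: avg_add avg_cmult avg_const odd IH)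
      finally have 1: "avg V (\<lambda>h. (\<Sum>i\<in>insert k A. h i)^2) = card (insert k A)" .
      have expand: "(u + v)^4 = v^4 + 4 * (u * v^3) + 6 * v^2 + 4 * (u * v) + 1"
        if u: "u * u = 1" for u v :: real
      proof -
        have "(u + v)^4 = (u*u)*(u*u) + 4 * (u*u)*(u * v) + 6 * (u*u) * v^2 + 4 * u * v^3 + v^4"
          by algebra
        then show ?thesis by (simp add: u)
      qed
      have "avg V (\<lambda>h. (\<Sum>i\<in>insert k A. h i)^4) =
          avg V (\<lambda>h. ?z h^4 + 4 * (h k * ?z h^3) + 6 * ?z h^2 + 4 * (h k * ?z h) + 1)"
        using insert.hyps by (intro avg_cong) (simp add: expand sign_of_sq)
      also have "\<dots> = avg V (\<lambda>h. ?z h^4) + 6 * card A + 1"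
        using assms(1) by (simp add: avg_add avg_cmult avg_const odd IH)
      \<comment> \<open>With \<open>a = card A\<close> this is 3a^2 + 6a + 1 <= 3(a+1)^2.\<close>
      also have "\<dots> \<le> 3 * (real (card (insert k A)))^2"
        using insert.hyps IH(2) by (simp add: power2_eq_square algebra_simps)
      finally show "avg V (\<lambda>h. (\<Sum>i\<in>insert k A. h i)^2) = card (insert k A) \<and>
          avg V (\<lambda>h. (\<Sum>i\<in>insert k A. h i)^4) \<le> 3 * (real (card (insert k A)))^2"
        using 1 by blast
    qed
  qed
  then show "avg V (\<lambda>h. (\<Sum>i\<in>A. h i)^2) = card A"
    and "avg V (\<lambda>h. (\<Sum>i\<in>A. h i)^4) \<le> 3 * (real (card A))^2"
    using assms by auto
qed

section \<open>Truncated normalized sums\<close>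

text \<open>The threshold 2 is low enough for \<open>tilt\<close> to stay in [-1, 1] when
  \<open>\<delta> \<le> 1/2\<close>, and high enough that a variable with second moment 1 and fourth
  moment at most 3 keeps a positive correlation with its truncation.\<close>

definition clip :: "real \<Rightarrow> real" where
  "clip t = max (-2) (min 2 t)"

lemma clip_minus: "clip (- t) = - clip t"
  by (simp add: clip_def max_def min_def)

lemma abs_clip_le: "\<bar>clip t\<bar> \<le> 2"
  by (auto simp: clip_def max_def min_def abs_le_iff)

lemma clip_lipschitz: "\<bar>clip s - clip t\<bar> \<le> \<bar>s - t\<bar>"
  by (simp add: clip_def max_def min_def)

text \<open>A polynomial minorant, so that two moments suffice below: inside the window
  \<open>clip\<close> is the identity, and outside it the right side is at most 0 while the left
  side is nonnegative.\<close>

lemma mult_clip_ge: "t * clip t \<ge> t^2 - t^4 / 4"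
proof (cases "\<bar>t\<bar> \<le> 2")
  case True
  then have "clip t = t" by (auto simp: clip_def max_def min_def)
  then show ?thesis by (simp add: power2_eq_square)
next
  case False
  then have "2^2 \<le> \<bar>t\<bar>^2" by (intro power_mono) auto
  then have "t^2 * 4 \<le> t^2 * t^2" by (intro mult_left_mono) auto
  then have "t^2 - t^4/4 \<le> 0" by (simp add: power_add[symmetric])
  moreover have "0 \<le> t * clip t"
    using False by (auto simp: clip_def max_def min_def zero_le_mult_iff)
  ultimately show ?thesis by linarith
qed

text \<open>Normalized to variance 1 for nonempty \<open>A\<close>; for empty \<open>A\<close> the
  value is 0/0 = 0.\<close>

definition nsum :: "'a set \<Rightarrow> ('a \<Rightarrow> real) \<Rightarrow> real" where
  "nsum A h = (\<Sum>i\<in>A. h i) / sqrt (card A)"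

text \<open>Insert the moments into \<open>mult_clip_ge\<close>: the result is at least 1 -
  3/4.\<close>

lemma avg_nsum_clip_ge:
  assumes "finite V" "A \<subseteq> V" "A \<noteq> {}"
  shows "avg V (\<lambda>h. nsum A h * clip (nsum A h)) \<ge> 1/4"
proof -
  have c: "real (card A) > 0"
    using assms finite_subset by (auto simp: card_gt_0_iff)
  have s4: "sqrt (real (card A)) ^ 4 = (real (card A))\<^sup>2"
    by (simp add: power4_eq_xxxx power2_eq_square)
  have p: "nsum A h ^2 = (1 / card A) * (\<Sum>i\<in>A. h i)^2"
       "nsum A h ^4 = (1 / (card A)^2) * (\<Sum>i\<in>A. h i)^4" for h
    by (simp_all add: nsum_def power_divide s4)
  have "avg V (\<lambda>h. nsum A h ^2) = 1"
    unfolding p avg_cmult avg_sum_moments(1)[OF assms(1,2)] using c by simp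
  moreover have "avg V (\<lambda>h. nsum A h ^4) \<le> 3"
    unfolding p avg_cmult using avg_sum_moments(2)[OF assms(1,2)] c
    by (simp add: divide_le_eq)
  ultimately have "1/4 \<le> avg V (\<lambda>h. nsum A h^2 - (1/4) * nsum A h^4)"
    by (simp only: avg_diff avg_cmult)
  also have "\<dots> \<le> avg V (\<lambda>h. nsum A h * clip (nsum A h))"
    using mult_clip_ge by (intro avg_mono) simp
  finally show ?thesis .
qed

text \<open>Flipping all signs on \<open>A - B\<close>, and independently all those on \<open>B - A\<close>, preserves the
  average. After averaging over these flips each factor is, by oddness and the Lipschitz property
  of \<^const>\<open>clip\<close>, at most the absolute value of the sum over \<open>A \<inter> B\<close> divided by
  the respective normalization.\<close>

lemma avg_clip_clip_le:
  assumes fin: "finite V" and sub: "A \<subseteq> V" "B \<subseteq> V"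
  shows "avg V (\<lambda>h. clip (nsum A h) * clip (nsum B h))
    \<le> card (A \<inter> B) / (sqrt (card A) * sqrt (card B))"
proof -
  let ?a = "sqrt (card A)" and ?b = "sqrt (card B)"
  let ?z = "\<lambda>h :: 'a \<Rightarrow> real. \<Sum>i\<in>A\<inter>B. h i"
  let ?x = "\<lambda>h :: 'a \<Rightarrow> real. \<Sum>i\<in>A-B. h i"
  let ?y = "\<lambda>h :: 'a \<Rightarrow> real. \<Sum>i\<in>B-A. h i"
  let ?f = "\<lambda>z x. clip ((z + x) / ?a)" and ?g = "\<lambda>z y. clip ((z + y) / ?b)"
  have finAB: "finite A" "finite B" using fin sub finite_subset by blast+
  have dec: "nsum A h = (?z h + ?x h) / ?a" "nsum B h = (?z h + ?y h) / ?b" for h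
    unfolding nsum_def using sum.Int_Diff[OF finAB(1), of h B] sum.Int_Diff[OF finAB(2), of h A]
    by (simp_all add: Int_commute)
  have X: "?z (flip (A-B) h) = ?z h" "?x (flip (A-B) h) = - ?x h" "?y (flip (A-B) h) = ?y h"
    and Y: "?z (flip (B-A) h) = ?z h" "?y (flip (B-A) h) = - ?y h" "?x (flip (B-A) h) = ?x h" for h
    by (auto intro!: sum_flip_disjoint sum_flip_subset)
  let ?H = "\<lambda>h. ?f (?z h) (?x h) * ?g (?z h) (?y h)"
  have sX: "A - B \<subseteq> V" and sY: "B - A \<subseteq> V" using sub by auto
  have 1: "avg V (\<lambda>h. ?f (?z h) (- ?x h) * ?g (?z h) (?y h)) = avg V ?H"
    using avg_flip[OF sX, of ?H] by (simp only: X)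
  have 2: "avg V (\<lambda>h. ?f (?z h) (?x h) * ?g (?z h) (- ?y h)) = avg V ?H"
    using avg_flip[OF sY, of ?H] by (simp only: Y)
  have 3: "avg V (\<lambda>h. ?f (?z h) (- ?x h) * ?g (?z h) (- ?y h)) = avg V ?H"
    using avg_flip[OF sX, of "\<lambda>h. ?f (?z h) (?x h) * ?g (?z h) (- ?y h)"] 2 by (simp only: X)
  have half: "\<bar>clip ((z + x) / r) + clip ((z + - x) / r)\<bar> \<le> 2 * \<bar>z\<bar> / r" if "r \<ge> 0" for z x r
  proof -
    have "clip ((z + - x) / r) = - clip ((x - z) / r)"
      using clip_minus[of "(x - z) / r"] by (simp add: minus_divide_left)
    then have "\<bar>clip ((z + x) / r) + clip ((z + - x) / r)\<bar> \<le> \<bar>(z + x) / r - (x - z) / r\<bar>"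
      using clip_lipschitz[of "(z + x) / r" "(x - z) / r"] by simp
    also have "(z + x) / r - (x - z) / r = 2 * z / r" by (simp add: diff_divide_distrib[symmetric])
    finally show ?thesis using that by (simp add: abs_mult)
  qed
  have "4 * avg V ?H = avg V (\<lambda>h. (?f (?z h) (?x h) + ?f (?z h) (- ?x h)) *
      (?g (?z h) (?y h) + ?g (?z h) (- ?y h)))"
    unfolding distrib_left distrib_right avg_add 1 2 3 by simp
  also have "\<dots> \<le> avg V (\<lambda>h. 4 / (?a * ?b) * (?z h)^2)"
  proof (rule avg_mono)
    fix S :: "'a set"
    let ?h = "sign_of S"
    let ?F = "?f (?z ?h) (?x ?h) + ?f (?z ?h) (- ?x ?h)"
    let ?G = "?g (?z ?h) (?y ?h) + ?g (?z ?h) (- ?y ?h)"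
    have "?F * ?G \<le> \<bar>?F\<bar> * \<bar>?G\<bar>" by (simp add: abs_mult[symmetric])
    also have "\<dots> \<le> (2 * \<bar>?z ?h\<bar> / ?a) * (2 * \<bar>?z ?h\<bar> / ?b)"
      by (intro mult_mono half) auto
    also have "\<dots> = 4 / (?a * ?b) * (?z ?h)^2"
      by (simp add: power2_eq_square abs_mult_self_eq)
    finally show "?F * ?G \<le> 4 / (?a * ?b) * (?z ?h)^2" .
  qed
  also have "\<dots> = 4 * (card (A \<inter> B) / (?a * ?b))"
    unfolding avg_cmult using avg_sum_moments(1)[OF fin, of "A \<inter> B"] sub by (simp add: le_infI1)
  finally show ?thesis by (simp add: dec)
qed

section \<open>Rounding a multilinear form\<close>

text \<open>An affine function on [-1, 1] is minimized at an endpoint, so coordinates are rounded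
  one by one. Keeping \<open>\<sigma>\<close> equal to \<open>y\<close> outside \<open>V\<close>
  ensures that the next coordinate still lies in [-1, 1].\<close>

lemma multilinear_rounding:
  fixes F :: "('a \<Rightarrow> real) \<Rightarrow> real"
  assumes "finite V"
    and affine: "\<And>y k. \<exists>a b. \<forall>t. F (y(k := t)) = a + b * t"
    and y: "\<And>i. i \<in> V \<Longrightarrow> \<bar>y i\<bar> \<le> 1"
  shows "\<exists>\<sigma>. (\<forall>i\<in>V. \<bar>\<sigma> i\<bar> = 1) \<and> (\<forall>i. i \<notin> V \<longrightarrow> \<sigma> i = y i) \<and> F \<sigma> \<le> F y"
  using assms(1) y
proof (induction V)
  case (insert k V)
  obtain \<sigma> where \<sigma>: "\<forall>i\<in>V. \<bar>\<sigma> i\<bar> = 1" "\<forall>i. i \<notin> V \<longrightarrow> \<sigma> i = y i" "F \<sigma> \<le> F y"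
    using insert.IH insert.prems by auto
  obtain a b where ab: "\<And>t. F (\<sigma>(k := t)) = a + b * t" using affine by blast
  \<comment> \<open>The endpoint that the sign of the slope \<open>b\<close> favors.\<close>
  define t :: real where "t = (if b \<ge> 0 then -1 else 1)"
  have k: "\<bar>\<sigma> k\<bar> \<le> 1" using \<sigma>(2) insert.hyps insert.prems by simp
  have "b * t \<le> b * \<sigma> k"
  proof (cases "b \<ge> 0")
    case True
    then have "b * (-1) \<le> b * \<sigma> k" using k by (intro mult_left_mono) auto
    then show ?thesis using True by (simp add: t_def)
  next
    case False
    then have "b * 1 \<le> b * \<sigma> k" using k by (intro mult_left_mono_neg) auto
    then show ?thesis using False by (simp add: t_def)
  qed
  then have "F (\<sigma>(k := t)) \<le> F \<sigma>" using ab[of t] ab[of "\<sigma> k"] by simp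
  then have "F (\<sigma>(k := t)) \<le> F y" using \<sigma>(3) by (rule order_trans)
  moreover have "\<forall>i\<in>insert k V. \<bar>(\<sigma>(k := t)) i\<bar> = 1"
    using \<sigma>(1) by (simp add: t_def)
  moreover have "\<forall>i. i \<notin> insert k V \<longrightarrow> (\<sigma>(k := t)) i = y i"
    using \<sigma>(2) by simp
  ultimately show ?case by blast
qed auto

lemma affine_sum:
  fixes f :: "'i \<Rightarrow> real \<Rightarrow> real"
  assumes "\<And>i. i \<in> I \<Longrightarrow> \<exists>a b. \<forall>t. f i t = a + b * t"
  shows "\<exists>a b. \<forall>t. (\<Sum>i\<in>I. f i t) = a + b * t"
proof -
  obtain a b where ab: "\<And>i t. i \<in> I \<Longrightarrow> f i t = a i + b i * t"
    using assms by metis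
  have "(\<Sum>i\<in>I. f i t) = (\<Sum>i\<in>I. a i) + (\<Sum>i\<in>I. b i) * t" for t
    by (simp add: ab sum.distrib sum_distrib_right)
  then show ?thesis by blast
qed

text \<open>Without diagonal terms each coordinate occurs to degree at most one in every summand, so
  the form is affine in each coordinate.\<close>

lemma off_diagonal_rounding:
  fixes w :: "'a \<Rightarrow> 'a \<Rightarrow> real"
  assumes "finite V" and "\<And>i. i \<in> V \<Longrightarrow> \<bar>y i\<bar> \<le> 1"
  shows "\<exists>\<sigma>. (\<forall>i\<in>V. \<bar>\<sigma> i\<bar> = 1) \<and>
    (\<Sum>i\<in>V. \<Sum>j\<in>V-{i}. w i j * (\<sigma> i * \<sigma> j)) \<le> (\<Sum>i\<in>V. \<Sum>j\<in>V-{i}. w i j * (y i * y j))"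
proof -
  let ?F = "\<lambda>y. \<Sum>i\<in>V. \<Sum>j\<in>V-{i}. w i j * (y i * y j)"
  have "\<exists>a b. \<forall>t. w i j * ((y(k := t)) i * (y(k := t)) j) = a + b * t"
    if "j \<in> V - {i}" for y :: "'a \<Rightarrow> real" and i j k
  proof -
    consider "k = i" | "k = j" "k \<noteq> i" | "k \<noteq> i" "k \<noteq> j" by blast
    then show ?thesis
    proof cases
      case 1
      then show ?thesis using that by (intro exI[of _ 0] exI[of _ "w i j * y j"]) auto
    next
      case 2
      then show ?thesis by (intro exI[of _ 0] exI[of _ "w i j * y i"]) auto
    next
      case 3
      then show ?thesis by (intro exI[of _ "w i j * (y i * y j)"] exI[of _ 0]) auto
    qed
  qed
  then have "\<exists>a b. \<forall>t. ?F (y(k := t)) = a + b * t" for y :: "'a \<Rightarrow> real" and k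
    by (intro affine_sum)
  from multilinear_rounding[of V ?F y, OF assms(1) this assms(2)] show ?thesis by blast
qed

text \<open>Discarding the heaviest element never raises the average weight; repeat until
  \<open>t\<close> elements remain. This selects the low-degree vertices to be moved when
  balancing.\<close>

lemma ex_light_subset:
  fixes f :: "'a \<Rightarrow> real"
  assumes "finite A" "t \<le> card A"
  shows "\<exists>T\<subseteq>A. card T = t \<and> card A * (\<Sum>i\<in>T. f i) \<le> t * (\<Sum>i\<in>A. f i)"
  using assms
proof (induction "card A" arbitrary: A)
  case (Suc k)
  show ?case
  proof (cases "t = card A")
    case False
    have ne: "A \<noteq> {}" using Suc.hyps by auto
    then have "Max (f ` A) \<in> f ` A" using Suc.prems by (intro Max_in) auto
    then obtain a where a: "a \<in> A" "f a = Max (f ` A)" by auto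
    have le: "f i \<le> f a" if "i \<in> A" for i
      unfolding a(2) using that Suc.prems by (intro Max_ge) auto
    have c: "card A = k + 1" "card (A - {a}) = k" using Suc.hyps(2) Suc.prems a by auto
    obtain T where T: "T \<subseteq> A - {a}" "card T = t"
        "card (A - {a}) * (\<Sum>i\<in>T. f i) \<le> t * (\<Sum>i\<in>A-{a}. f i)"
      using Suc.hyps(1)[of "A - {a}"] c Suc.prems False by auto
    \<comment> \<open>Added to the induction hypothesis, this raises the factor on the left from
      \<open>k\<close> to \<open>k + 1\<close> and restores the weight of \<open>a\<close> on the
      right.\<close>
    have "(\<Sum>i\<in>T. f i) \<le> t * f a"
      using sum_bounded_above[of T f "f a"] T le by auto
    then have "card A * (\<Sum>i\<in>T. f i) \<le> t * (\<Sum>i\<in>A-{a}. f i) + t * f a"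
      using T(3) unfolding c by (simp add: algebra_simps)
    also have "\<dots> = t * (\<Sum>i\<in>A. f i)"
      using sum.remove[OF Suc.prems(1) a(1), of f] by (simp add: algebra_simps)
    finally show ?thesis using T by blast
  qed auto
qed auto

section \<open>Counting edges\<close>

definition adj :: "'a set set \<Rightarrow> 'a \<Rightarrow> 'a \<Rightarrow> real" where
  "adj E i j = of_bool ({i, j} \<in> E)"

lemma adj_commute: "adj E i j = adj E j i"
  by (simp add: adj_def insert_commute)

lemma adj_nonneg [simp]: "adj E i j \<ge> 0"
  by (simp add: adj_def)

locale sgraph =
  fixes V :: "'a set" and E :: "'a set set"
  assumes simple: "simple_graph V E"
begin

abbreviation N where "N \<equiv> neighborhood E"
abbreviation deg where "deg \<equiv> vertex_degree E"

lemma finite_V: "finite V"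
  using simple by (simp add: simple_graph_def)

lemma finite_E: "finite E"
proof (rule finite_subset)
  show "E \<subseteq> Pow V" using simple by (auto simp: simple_graph_def)
qed (simp add: finite_V)

lemma edge_cases:
  assumes "e \<in> E"
  obtains a b where "e = {a, b}" "a \<noteq> b" "a \<in> V" "b \<in> V"
proof -
  have "card e = 2" "e \<subseteq> V" using assms simple by (auto simp: simple_graph_def)
  then show ?thesis using that by (auto simp: card_2_iff)
qed

lemma adj_self: "adj E i i = 0"
  using edge_cases[of "{i}"] by (force simp: adj_def)

lemma neighborhood_subset: "N i \<subseteq> V"
proof
  fix j assume "j \<in> N i"
  then have "{j, i} \<in> E" by (simp add: neighborhood_def)
  then show "j \<in> V" using simple by (auto simp: simple_graph_def)
qed

lemma finite_neighborhood: "finite (N i)"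
  using neighborhood_subset finite_V finite_subset by blast

lemma adj_eq_of_bool: "adj E i j = of_bool (j \<in> N i)" "adj E i j = of_bool (i \<in> N j)"
  by (simp_all add: adj_def neighborhood_def insert_commute)

lemma sum_adj_mult:
  "(\<Sum>j\<in>V. adj E i j * f j) = (\<Sum>j\<in>N i. f j)"
proof -
  have "(\<Sum>j\<in>V. adj E i j * f j) = (\<Sum>j\<in>N i. adj E i j * f j)"
    using neighborhood_subset finite_V by (intro sum.mono_neutral_right) (auto simp: adj_eq_of_bool(1))
  then show ?thesis by (simp add: adj_eq_of_bool(1))
qed

lemma sum_adj_row: "(\<Sum>j\<in>V. adj E i j) = deg i"
  using sum_adj_mult[of i "\<lambda>_. 1"] by (simp add: vertex_degree_def)

text \<open>Count ordered pairs by the edge they span: each edge \<open>{a, b}\<close> arises from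
  exactly \<open>(a, b)\<close> and \<open>(b, a)\<close>.\<close>

lemma sum_sum_adj: "(\<Sum>i\<in>V. \<Sum>j\<in>V. adj E i j) = 2 * real (card E)"
proof -
  have fib: "(\<Sum>p\<in>V\<times>V. of_bool ({fst p, snd p} = e)) = (2::real)" if e: "e \<in> E" for e
  proof -
    obtain a b where ab: "e = {a, b}" "a \<noteq> b" "a \<in> V" "b \<in> V" by (rule edge_cases[OF e])
    have "{p \<in> V\<times>V. {fst p, snd p} = e} = {(a,b),(b,a)}"
      using ab by (auto simp: doubleton_eq_iff)
    then have "card (V\<times>V \<inter> {p. {fst p, snd p} = e}) = 2"
      using ab by (simp add: Int_def)
    then show ?thesis using finite_V by (simp add: sum_of_bool_eq)
  qed
  have "(\<Sum>i\<in>V. \<Sum>j\<in>V. adj E i j) = (\<Sum>p\<in>V\<times>V. of_bool ({fst p, snd p} \<in> E))"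
    by (simp add: sum.cartesian_product adj_def case_prod_beta)
  also have "\<dots> = (\<Sum>p\<in>V\<times>V. \<Sum>e\<in>E. of_bool ({fst p, snd p} = e))"
    using finite_E by (intro sum.cong) (auto simp: of_bool_def)
  also have "\<dots> = (\<Sum>e\<in>E. \<Sum>p\<in>V\<times>V. of_bool ({fst p, snd p} = e))"
    by (rule sum.swap)
  also have "\<dots> = 2 * real (card E)" by (simp add: fib)
  finally show ?thesis .
qed

lemma sum_deg: "(\<Sum>i\<in>V. real (deg i)) = 2 * real (card E)"
  using sum_sum_adj by (simp add: sum_adj_row)

text \<open>Disjointness makes the map from a pair in \<open>A \<times> B\<close> to its edge
  injective.\<close>

lemma card_cut_edges:
  assumes "A \<subseteq> V" "B \<subseteq> V" "A \<inter> B = {}"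
  shows "real (card (cut_edges E A B)) = (\<Sum>i\<in>A. \<Sum>j\<in>B. adj E i j)"
proof -
  have fin: "finite A" "finite B" using assms finite_V finite_subset by blast+
  let ?P = "{p \<in> A \<times> B. {fst p, snd p} \<in> E}"
  have "cut_edges E A B = (\<lambda>p. {fst p, snd p}) ` ?P"
    by (force simp: cut_edges_def image_iff)
  moreover have "inj_on (\<lambda>p. {fst p, snd p}) ?P"
    using assms(3) by (auto simp: inj_on_def doubleton_eq_iff)
  ultimately have "card (cut_edges E A B) = card ?P" by (simp add: card_image)
  also have "real \<dots> = (\<Sum>p\<in>A\<times>B. of_bool ({fst p, snd p} \<in> E))"
    using fin by (simp add: sum_of_bool_eq Int_def)
  finally show ?thesis by (simp add: sum.cartesian_product adj_def case_prod_beta)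
qed

text \<open>For a neighbor \<open>j\<close> of \<open>i\<close>, the codegree is the degree of
  \<open>j\<close> in the graph induced on \<open>N i\<close>; apply the handshake identity to that
  graph. Through this identity the sparsity hypothesis enters.\<close>

lemma sum_codegree:
  "(\<Sum>j\<in>N i. real (card (N i \<inter> N j))) = 2 * real (card (induced_edges E (N i)))"
proof -
  interpret I: sgraph "N i" "induced_edges E (N i)"
    using simple finite_neighborhood by unfold_locales (auto simp: simple_graph_def induced_edges_def)
  have "real (card (N i \<inter> N j)) = (\<Sum>k\<in>N i. adj (induced_edges E (N i)) j k)" if "j \<in> N i" for j
  proof -
    have "(\<Sum>k\<in>N i. adj (induced_edges E (N i)) j k) = (\<Sum>k\<in>N i. of_bool (k \<in> N j))"
      using that by (intro sum.cong) (auto simp: adj_def induced_edges_def neighborhood_def insert_commute)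
    then show ?thesis using finite_neighborhood by (simp add: sum_of_bool_eq Int_def)
  qed
  then show ?thesis using I.sum_sum_adj by simp
qed

text \<open>Both sides count walks of length two from \<open>i\<close>, by endpoint \<open>j\<close>
  and by midpoint \<open>k\<close>.\<close>

lemma sum_codegree_all:
  "(\<Sum>j\<in>V. real (card (N i \<inter> N j))) = (\<Sum>k\<in>N i. real (deg k))"
proof -
  have "(\<Sum>j\<in>V. real (card (N i \<inter> N j))) = (\<Sum>j\<in>V. \<Sum>k\<in>N i. adj E k j)"
    using finite_neighborhood by (simp add: adj_eq_of_bool(2) sum_of_bool_eq Int_def)
  also have "\<dots> = (\<Sum>k\<in>N i. \<Sum>j\<in>V. adj E k j)" by (rule sum.swap)
  finally show ?thesis by (simp add: sum_adj_row)
qed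

text \<open>The omitted term \<open>j = i\<close> is \<open>deg i\<close>, which gives the -1. This
  saving later pays for the diagonal of the squared imbalance.\<close>

lemma sum_codegree_off_diagonal:
  assumes "i \<in> V" "\<And>k. k \<in> V \<Longrightarrow> deg k \<le> D"
  shows "(\<Sum>j\<in>V-{i}. real (card (N i \<inter> N j))) \<le> deg i * (real D - 1)"
proof -
  have "(\<Sum>j\<in>V-{i}. real (card (N i \<inter> N j))) = (\<Sum>k\<in>N i. real (deg k)) - deg i"
    using sum_codegree_all[of i] sum.remove[OF finite_V assms(1), of "\<lambda>j. real (card (N i \<inter> N j))"]
    by (simp add: vertex_degree_def)
  also have "(\<Sum>k\<in>N i. real (deg k)) \<le> deg i * D"
    using sum_bounded_above[of "N i" "\<lambda>k. real (deg k)" "real D"] assms(2) neighborhood_subset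
    by (auto simp: vertex_degree_def)
  finally show ?thesis by (simp add: algebra_simps)
qed

section \<open>Balancing a partition\<close>

text \<open>Only edges meeting \<open>T\<close> can leave the cut, and each \<open>i\<close> in
  \<open>T\<close> accounts for at most \<open>deg i\<close> of them.\<close>

lemma card_cut_edges_move:
  assumes "finite T" "T \<subseteq> A"
  shows "real (card (cut_edges E A B)) - (\<Sum>i\<in>T. real (deg i)) \<le> card (cut_edges E (A - T) (B \<union> T))"
proof -
  let ?I = "\<lambda>i. (\<lambda>j. {j, i}) ` N i"
  have "cut_edges E A B \<subseteq> cut_edges E (A - T) (B \<union> T) \<union> (\<Union>i\<in>T. ?I i)"
    by (fastforce simp: cut_edges_def neighborhood_def insert_commute)
  moreover have "finite (cut_edges E (A - T) (B \<union> T))"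
    using finite_E by (simp add: cut_edges_def)
  ultimately have "card (cut_edges E A B) \<le> card (cut_edges E (A - T) (B \<union> T) \<union> (\<Union>i\<in>T. ?I i))"
    using assms finite_neighborhood by (intro card_mono) auto
  also have "\<dots> \<le> card (cut_edges E (A - T) (B \<union> T)) + card (\<Union>i\<in>T. ?I i)"
    by (rule card_Un_le)
  also have "card (\<Union>i\<in>T. ?I i) \<le> (\<Sum>i\<in>T. card (?I i))"
    using assms by (intro card_UN_le)
  also have "\<dots> \<le> (\<Sum>i\<in>T. deg i)"
    unfolding vertex_degree_def using finite_neighborhood by (intro sum_mono card_image_le)
  finally have "real (card (cut_edges E A B)) \<le> real (card (cut_edges E (A - T) (B \<union> T)) + (\<Sum>i\<in>T. deg i))"
    by linarith
  then show ?thesis by simp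
qed

lemma cut_edges_commute: "cut_edges E A B = cut_edges E B A"
  by (auto simp: cut_edges_def insert_commute)

lemma balance_cut_larger:
  assumes "A \<union> B = V" "A \<inter> B = {}" "card B \<le> card A" "V \<noteq> {}"
  shows "\<exists>A' B'. bisection V A' B' \<and> real (card (cut_edges E A' B')) \<ge>
    real (card (cut_edges E A B)) - 2 * real (card E) / card V * (real (card A) - real (card B))"
proof -
  have fin: "finite A" "finite B" using assms(1) finite_V by auto
  have n: "card V = card A + card B" using assms fin card_Un_disjoint by metis
  have n0: "card V > 0" using assms(4) finite_V by (simp add: card_gt_0_iff)
  \<comment> \<open>Moving \<open>t\<close> vertices changes the difference of the sizes by
    \<open>2 * t\<close>; rounding down leaves a difference of 0 or 1.\<close>
  define t where "t = (card A - card B) div 2"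
  obtain T where T: "T \<subseteq> A" "card T = t" "card A * (\<Sum>i\<in>T. real (deg i)) \<le> t * (\<Sum>i\<in>A. real (deg i))"
    using ex_light_subset[OF fin(1), of t "\<lambda>i. real (deg i)"] unfolding t_def by fastforce
  have finT: "finite T" using T fin finite_subset by blast
  have "bisection V (A - T) (B \<union> T)"
  proof -
    have "card (A - T) = card A - t" using T finT by (simp add: card_Diff_subset)
    moreover have "card (B \<union> T) = card B + t" using T finT fin assms(2)
      by (subst card_Un_disjoint) auto
    ultimately have "\<bar>int (card (A - T)) - int (card (B \<union> T))\<bar> \<le> 1"
      using assms(3) unfolding t_def by linarith
    then show ?thesis using assms T by (auto simp: bisection_def)
  qed
  moreover have "(\<Sum>i\<in>T. real (deg i)) \<le> 2 * real (card E) / card V * (real (card A) - real (card B))"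
  proof -
    let ?s = "\<Sum>i\<in>T. real (deg i)"
    \<comment> \<open>The larger part holds at least half of the vertices, so the average over
      \<open>A\<close> can be compared with an average over \<open>V\<close>.\<close>
    have "card V * ?s \<le> (2 * card A) * ?s"
      using n assms(3) by (intro mult_right_mono) (auto simp: sum_nonneg)
    also have "\<dots> \<le> 2 * (t * (\<Sum>i\<in>A. real (deg i)))" using T(3) by simp
    also have "\<dots> \<le> 2 * (t * (2 * real (card E)))"
      unfolding sum_deg[symmetric] using assms(1) finite_V
      by (intro mult_left_mono sum_mono2) auto
    also have "\<dots> = (2 * real t) * (2 * real (card E))" by simp
    also have "\<dots> \<le> (real (card A) - real (card B)) * (2 * real (card E))"
    proof (intro mult_right_mono)
      have "2 * t \<le> card A - card B" by (simp add: t_def)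
      then show "2 * real t \<le> real (card A) - real (card B)" using assms(3) by linarith
    qed simp
    finally show ?thesis using n0 by (simp add: field_simps)
  qed
  ultimately show ?thesis
    using card_cut_edges_move[OF finT T(1), of B] by (intro exI[of _ "A - T"] exI[of _ "B \<union> T"]) linarith
qed

lemma balance_cut:
  assumes "A \<union> B = V" "A \<inter> B = {}" "V \<noteq> {}"
  shows "\<exists>A' B'. bisection V A' B' \<and> real (card (cut_edges E A' B')) \<ge>
    real (card (cut_edges E A B)) - 2 * real (card E) / card V * \<bar>real (card A) - real (card B)\<bar>"
proof (cases "card B \<le> card A")
  case True
  then show ?thesis using balance_cut_larger[of A B] assms by simp
next
  case False
  then show ?thesis
    using balance_cut_larger[of B A] assms by (simp add: Un_commute Int_commute cut_edges_commute[of A B])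
qed

text \<open>The product of two signs is 1 within a part and -1 across, so subtracting the quadratic
  form from the ordered pair count \<open>2 * card E\<close> leaves four times the cut.\<close>

lemma cut_of_signs:
  assumes \<sigma>: "\<And>i. i \<in> V \<Longrightarrow> \<bar>\<sigma> i\<bar> = (1::real)"
  defines "A \<equiv> {i \<in> V. \<sigma> i = 1}" and "B \<equiv> {i \<in> V. \<sigma> i \<noteq> 1}"
  shows "real (card (cut_edges E A B)) = card E / 2 - (\<Sum>i\<in>V. \<Sum>j\<in>V. adj E i j * (\<sigma> i * \<sigma> j)) / 4"
    and "real (card A) - real (card B) = (\<Sum>i\<in>V. \<sigma> i)"
proof -
  have AB: "A \<subseteq> V" "B \<subseteq> V" "A \<inter> B = {}" "A \<union> B = V" by (auto simp: A_def B_def)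
  have fin: "finite A" "finite B" using AB finite_V finite_subset by blast+
  have B1: "\<sigma> i = -1" if "i \<in> B" for i using that \<sigma>[of i] by (auto simp: B_def)
  have A1: "\<sigma> i = 1" if "i \<in> A" for i using that by (auto simp: A_def)
  have split: "(\<Sum>i\<in>V. f i) = (\<Sum>i\<in>A. f i) + (\<Sum>i\<in>B. f i)" for f :: "'a \<Rightarrow> real"
    using sum.union_disjoint[OF fin AB(3)] AB(4) by simp
  show "real (card A) - real (card B) = (\<Sum>i\<in>V. \<sigma> i)"
    by (simp add: split A1 B1)
  let ?e = "\<lambda>X Y. \<Sum>i\<in>X. \<Sum>j\<in>Y. adj E i j"
  have BA: "?e B A = ?e A B"
    by (subst sum.swap) (simp add: adj_commute)
  have "2 * card E = ?e A A + 2 * ?e A B + ?e B B"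
    using sum_sum_adj BA by (simp add: split sum.distrib)
  moreover have "(\<Sum>i\<in>V. \<Sum>j\<in>V. adj E i j * (\<sigma> i * \<sigma> j)) = ?e A A - 2 * ?e A B + ?e B B"
    using BA by (simp add: split sum.distrib sum_subtractf sum_negf A1 B1)
  ultimately show "real (card (cut_edges E A B)) =
      card E / 2 - (\<Sum>i\<in>V. \<Sum>j\<in>V. adj E i j * (\<sigma> i * \<sigma> j)) / 4"
    using card_cut_edges[OF AB(1-3)] by (simp add: field_simps)
qed

section \<open>Tilting signs against the neighborhood\<close>

text \<open>The division by 2 keeps the tilted vector in [-1, 1] for
  \<open>\<delta> \<le> 1/2\<close>, as rounding requires.\<close>

definition tilt :: "real \<Rightarrow> ('a \<Rightarrow> real) \<Rightarrow> 'a \<Rightarrow> real" where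
  "tilt \<delta> h i = (h i - \<delta> * clip (nsum (N i) h)) / 2"

definition corr :: "'a \<Rightarrow> real" where
  "corr j = avg V (\<lambda>h. nsum (N j) h * clip (nsum (N j) h))"

text \<open>The factor \<open>sqrt (deg j)\<close> lets the bound cover isolated vertices, where
  both sides are 0.\<close>

lemma corr_ge: "sqrt (deg j) * corr j \<ge> sqrt (deg j) / 4"
proof (cases "N j = {}")
  case False
  then have "1/4 \<le> corr j"
    unfolding corr_def using finite_V neighborhood_subset by (intro avg_nsum_clip_ge)
  then show ?thesis using mult_left_mono[of "1/4" "corr j" "sqrt (deg j)"] by simp
qed (simp add: vertex_degree_def)

section \<open>Correlations between signs and truncated neighborhood sums\<close>

lemma nsum_flip_notin: "k \<notin> N j \<Longrightarrow> nsum (N j) (flip {k} h) = nsum (N j) h"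
  unfolding nsum_def by (subst sum_flip_disjoint) auto

lemma avg_sign_clip_nonadjacent:
  assumes "i \<in> V" "i \<notin> N j"
  shows "avg V (\<lambda>h. h i * clip (nsum (N j) h)) = 0"
  using assms by (intro avg_sign_mult_eq_0) (simp_all add: nsum_flip_notin)

text \<open>By linearity the signs over \<open>N j\<close> add up to \<open>sqrt (deg j)\<close>
  times the normalized sum.\<close>

lemma sum_avg_sign_clip:
  "(\<Sum>i\<in>N j. avg V (\<lambda>h. h i * clip (nsum (N j) h))) = sqrt (deg j) * corr j"
proof -
  have "(\<Sum>i\<in>N j. avg V (\<lambda>h. h i * clip (nsum (N j) h)))
      = avg V (\<lambda>h. (\<Sum>i\<in>N j. h i) * clip (nsum (N j) h))"
    by (simp add: avg_sum[symmetric] sum_distrib_right)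
  also have "\<dots> = avg V (\<lambda>h. sqrt (deg j) * (nsum (N j) h * clip (nsum (N j) h)))"
  proof (cases "N j = {}")
    case False
    then have "sqrt (deg j) \<noteq> 0" using finite_neighborhood by (simp add: vertex_degree_def)
    then show ?thesis by (intro avg_cong) (simp add: nsum_def vertex_degree_def)
  qed (simp add: vertex_degree_def)
  finally show ?thesis by (simp add: avg_cmult corr_def)
qed

text \<open>Of the four products, the one of two distinct signs averages to 0 and the one of two
  truncations is bounded by the codegree. The mixed terms stay exact, since their lower bound
  appears only after summation.\<close>

lemma avg_tilt_mult_le:
  assumes "i \<in> V" "j \<in> V" "i \<noteq> j"
  shows "avg V (\<lambda>h. tilt \<delta> h i * tilt \<delta> h j) \<le>
    (\<delta>^2 * (card (N i \<inter> N j) / (sqrt (deg i) * sqrt (deg j)))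
     - \<delta> * avg V (\<lambda>h. h i * clip (nsum (N j) h)) - \<delta> * avg V (\<lambda>h. h j * clip (nsum (N i) h))) / 4"
proof -
  have 0: "avg V (\<lambda>h. h i * h j) = 0"
    using assms by (intro avg_sign_mult_eq_0) (auto simp: flip_def)
  have "avg V (\<lambda>h. tilt \<delta> h i * tilt \<delta> h j) = avg V (\<lambda>h. (1/4) * (h i * h j
      + \<delta>^2 * (clip (nsum (N i) h) * clip (nsum (N j) h))
      - \<delta> * (h i * clip (nsum (N j) h)) - \<delta> * (h j * clip (nsum (N i) h))))"
    by (intro avg_cong) (simp add: tilt_def power2_eq_square field_simps)
  also have "\<dots> = (\<delta>^2 * avg V (\<lambda>h. clip (nsum (N i) h) * clip (nsum (N j) h))
     - \<delta> * avg V (\<lambda>h. h i * clip (nsum (N j) h)) - \<delta> * avg V (\<lambda>h. h j * clip (nsum (N i) h))) / 4"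
    by (simp only: avg_cmult avg_add avg_diff 0) simp
  also have "\<dots> \<le> (\<delta>^2 * (card (N i \<inter> N j) / (sqrt (deg i) * sqrt (deg j)))
     - \<delta> * avg V (\<lambda>h. h i * clip (nsum (N j) h)) - \<delta> * avg V (\<lambda>h. h j * clip (nsum (N i) h))) / 4"
    unfolding vertex_degree_def
    by (intro divide_right_mono diff_right_mono mult_left_mono avg_clip_clip_le finite_V neighborhood_subset) auto
  finally show ?thesis .
qed

lemma abs_tilt_le:
  assumes "0 \<le> \<delta>" "\<delta> \<le> 1/2"
  shows "\<bar>tilt \<delta> (sign_of S) i\<bar> \<le> 1"
proof -
  have "\<delta> * \<bar>clip (nsum (N i) (sign_of S))\<bar> \<le> (1/2) * 2"
    using assms abs_clip_le by (intro mult_mono) auto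
  then have "\<bar>\<delta> * clip (nsum (N i) (sign_of S))\<bar> \<le> 1" using assms by (simp add: abs_mult)
  then show ?thesis using abs_sign_of[of S i] by (simp add: tilt_def)
qed

text \<open>AM-GM on the two inverse square roots; by symmetry of \<open>q\<close> both halves have
  the same sum. Terms with degree 0 are consistent because division by 0 gives 0.\<close>

lemma sum_symmetric_weight_le:
  fixes q :: "'a \<Rightarrow> 'a \<Rightarrow> real"
  assumes "\<And>i j. q i j = q j i" "\<And>i j. q i j \<ge> 0"
  shows "(\<Sum>i\<in>V. \<Sum>j\<in>V. q i j / (sqrt (deg i) * sqrt (deg j))) \<le> (\<Sum>i\<in>V. (\<Sum>j\<in>V. q i j) / deg i)"
proof -
  have "q i j / (sqrt (deg i) * sqrt (deg j)) \<le> q i j / deg i / 2 + q j i / deg j / 2" for i j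
  proof -
    let ?u = "1 / sqrt (deg i)" and ?v = "1 / sqrt (deg j)"
    have "?u * ?v \<le> (?u^2 + ?v^2) / 2" using sum_squares_bound[of ?u ?v] by simp
    then have "q i j * (?u * ?v) \<le> q i j * ((?u^2 + ?v^2) / 2)"
      using assms(2) by (intro mult_left_mono)
    then show ?thesis by (simp add: power_divide assms(1)[of j i] field_simps)
  qed
  then have "(\<Sum>i\<in>V. \<Sum>j\<in>V. q i j / (sqrt (deg i) * sqrt (deg j))) \<le>
      (\<Sum>i\<in>V. \<Sum>j\<in>V. q i j / deg i / 2 + q j i / deg j / 2)" by (intro sum_mono)
  also have "\<dots> = (\<Sum>i\<in>V. \<Sum>j\<in>V. q i j / deg i / 2) + (\<Sum>i\<in>V. \<Sum>j\<in>V. q j i / deg j / 2)"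
    by (simp only: sum.distrib)
  also have "(\<Sum>i\<in>V. \<Sum>j\<in>V. q j i / deg j / 2) = (\<Sum>i\<in>V. \<Sum>j\<in>V. q i j / deg i / 2)"
    by (rule sum.swap)
  finally show ?thesis by (simp add: sum.distrib[symmetric] sum_divide_distrib)
qed

lemma sum_sign_clip:
  "(\<Sum>i\<in>V. \<Sum>j\<in>V. adj E i j * avg V (\<lambda>h. h i * clip (nsum (N j) h))) = (\<Sum>j\<in>V. sqrt (deg j) * corr j)"
  "(\<Sum>i\<in>V. \<Sum>j\<in>V. adj E i j * avg V (\<lambda>h. h j * clip (nsum (N i) h))) = (\<Sum>j\<in>V. sqrt (deg j) * corr j)"
proof -
  show 2: "(\<Sum>i\<in>V. \<Sum>j\<in>V. adj E i j * avg V (\<lambda>h. h j * clip (nsum (N i) h))) = (\<Sum>j\<in>V. sqrt (deg j) * corr j)"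
    by (simp add: sum_adj_mult sum_avg_sign_clip)
  show "(\<Sum>i\<in>V. \<Sum>j\<in>V. adj E i j * avg V (\<lambda>h. h i * clip (nsum (N j) h))) = (\<Sum>j\<in>V. sqrt (deg j) * corr j)"
    using 2 by (subst sum.swap) (simp add: adj_commute)
qed

text \<open>The mixed terms gain at least \<open>\<delta> * ?D / 8\<close>, linear in
  \<open>\<delta>\<close>, while the codegree terms cost an amount quadratic in
  \<open>\<delta>\<close>.\<close>

lemma edge_correlation:
  assumes \<delta>: "0 \<le> \<delta>" "\<delta> * \<epsilon> \<le> 1/8"
    and sparse: "\<And>i. i \<in> V \<Longrightarrow> card (induced_edges E (N i)) \<le> \<epsilon> * real (deg i) powr (3/2)"
  shows "(\<Sum>i\<in>V. \<Sum>j\<in>V. adj E i j * avg V (\<lambda>h. tilt \<delta> h i * tilt \<delta> h j)) \<le> - \<delta> / 16 * (\<Sum>i\<in>V. sqrt (deg i))"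
proof -
  let ?D = "\<Sum>i\<in>V. sqrt (deg i)" and ?R = "\<Sum>j\<in>V. sqrt (deg j) * corr j"
  let ?q = "\<lambda>i j. adj E i j * card (N i \<inter> N j)"
  let ?Q = "\<Sum>i\<in>V. \<Sum>j\<in>V. ?q i j / (sqrt (deg i) * sqrt (deg j))"
  let ?g = "\<lambda>i j. avg V (\<lambda>h. h i * clip (nsum (N j) h))"
  have R: "?R \<ge> ?D / 4" unfolding sum_divide_distrib by (intro sum_mono corr_ge)
  have "?Q \<le> (\<Sum>i\<in>V. (\<Sum>j\<in>V. ?q i j) / deg i)"
    by (intro sum_symmetric_weight_le) (auto simp: adj_commute Int_commute)
  also have "\<dots> = (\<Sum>i\<in>V. 2 * card (induced_edges E (N i)) / deg i)"
    by (simp add: sum_adj_mult sum_codegree)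
  also have "\<dots> \<le> (\<Sum>i\<in>V. 2 * \<epsilon> * sqrt (deg i))"
  proof (rule sum_mono)
    fix i assume i: "i \<in> V"
    show "2 * card (induced_edges E (N i)) / deg i \<le> 2 * \<epsilon> * sqrt (deg i)"
    proof (cases "deg i = 0")
      case False
      \<comment> \<open>Dividing the sparsity bound by the degree leaves a square root, the same
        order as the gain.\<close>
      have "real (deg i) powr (3/2) = real (deg i) powr (1 + 1/2)" by simp
      also have "\<dots> = deg i * sqrt (deg i)"
        using False by (simp only: powr_add powr_half_sqrt powr_one)
      finally show ?thesis using sparse[OF i] False by (simp add: divide_le_eq mult_ac)
    qed simp
  qed
  finally have Q: "?Q \<le> 2 * \<epsilon> * ?D" by (simp add: sum_distrib_left)
  have "(\<Sum>i\<in>V. \<Sum>j\<in>V. adj E i j * avg V (\<lambda>h. tilt \<delta> h i * tilt \<delta> h j)) \<le>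
    (\<Sum>i\<in>V. \<Sum>j\<in>V. adj E i j * ((\<delta>^2 * (card (N i \<inter> N j) / (sqrt (deg i) * sqrt (deg j)))
       - \<delta> * ?g i j - \<delta> * ?g j i) / 4))"
  proof (intro sum_mono)
    fix i j assume "i \<in> V" "j \<in> V"
    then show "adj E i j * avg V (\<lambda>h. tilt \<delta> h i * tilt \<delta> h j) \<le> adj E i j *
      ((\<delta>^2 * (card (N i \<inter> N j) / (sqrt (deg i) * sqrt (deg j))) - \<delta> * ?g i j - \<delta> * ?g j i) / 4)"
      by (cases "i = j") (simp add: adj_self, intro mult_left_mono avg_tilt_mult_le adj_nonneg)
  qed
  also have "\<dots> = (\<Sum>i\<in>V. \<Sum>j\<in>V. \<delta>^2/4 * (?q i j / (sqrt (deg i) * sqrt (deg j)))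
       - \<delta>/4 * (adj E i j * ?g i j) - \<delta>/4 * (adj E i j * ?g j i))"
    by (intro sum.cong refl) (simp add: algebra_simps diff_divide_distrib)
  also have "\<dots> = \<delta>^2/4 * ?Q - \<delta>/4 * ?R - \<delta>/4 * ?R"
    by (simp only: sum_subtractf sum_distrib_left[symmetric] sum_sign_clip)
  also have "\<dots> \<le> \<delta>^2/4 * (2 * \<epsilon> * ?D) - \<delta>/4 * (?D/4) - \<delta>/4 * (?D/4)"
    using Q R \<delta> by (intro diff_mono mult_left_mono) auto
  also have "\<dots> = (\<delta> * \<epsilon>) * (\<delta> * ?D / 2) - \<delta> * ?D / 8" by (simp add: power2_eq_square)
  \<comment> \<open>The bound on \<open>\<delta> * \<epsilon>\<close> limits the cost to half of the
    gain.\<close>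
  also have "\<dots> \<le> 1/8 * (\<delta> * ?D / 2) - \<delta> * ?D / 8"
    using \<delta> by (intro diff_right_mono mult_right_mono) (auto intro!: mult_nonneg_nonneg sum_nonneg)
  finally show ?thesis by simp
qed

text \<open>Over all pairs the mixed terms again sum to a nonpositive amount and are dropped; the
  codegree terms are bounded through the maximum degree.\<close>

lemma total_correlation:
  assumes \<delta>: "0 \<le> \<delta>" "\<delta> \<le> 1/2" and D: "D \<ge> 1" "\<And>k. k \<in> V \<Longrightarrow> deg k \<le> D"
  shows "(\<Sum>i\<in>V. \<Sum>j\<in>V-{i}. avg V (\<lambda>h. tilt \<delta> h i * tilt \<delta> h j)) \<le> card V * (real D - 1)"
proof -
  let ?R = "\<Sum>j\<in>V. sqrt (deg j) * corr j"
  let ?g = "\<lambda>i j. avg V (\<lambda>h. h i * clip (nsum (N j) h))"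
  let ?q = "\<lambda>i j. if i = j then 0 else real (card (N i \<inter> N j))"
  let ?Q = "\<Sum>i\<in>V. \<Sum>j\<in>V. ?q i j / (sqrt (deg i) * sqrt (deg j))"
  have off: "(\<Sum>j\<in>V-{i}. f j) = (\<Sum>j\<in>V. if i = j then 0 else f j)" if "i \<in> V" for i and f :: "'a \<Rightarrow> real"
    using finite_V by (intro sum.mono_neutral_cong_left) auto
  have R: "?R \<ge> 0"
    by (intro sum_nonneg order_trans[OF _ corr_ge]) auto
  have "?Q \<le> (\<Sum>i\<in>V. (\<Sum>j\<in>V. ?q i j) / deg i)"
    by (intro sum_symmetric_weight_le) (auto simp: Int_commute)
  also have "\<dots> \<le> (\<Sum>i\<in>V. real D - 1)"
  proof (rule sum_mono)
    fix i assume i: "i \<in> V"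
    have "(\<Sum>j\<in>V. ?q i j) \<le> deg i * (real D - 1)"
      using sum_codegree_off_diagonal[OF i D(2)] off[OF i] by simp
    \<comment> \<open>For an isolated vertex the quotient is 0, and \<open>D \<ge> 1\<close> makes
      the right side nonnegative.\<close>
    then show "(\<Sum>j\<in>V. ?q i j) / deg i \<le> real D - 1"
      using D(1) by (cases "deg i = 0") (simp_all add: divide_le_eq mult_ac)
  qed
  finally have Q: "?Q \<le> card V * (real D - 1)" by simp
  \<comment> \<open>Nonadjacent pairs contribute 0, so the sum over all pairs reduces to the sum
    over edges evaluated in \<open>sum_sign_clip\<close>.\<close>
  have g: "?g i j = adj E i j * ?g i j" if "i \<in> V" for i j
    using avg_sign_clip_nonadjacent[OF that, of j] by (cases "i \<in> N j") (simp_all add: adj_eq_of_bool(2))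
  have "(\<Sum>i\<in>V. \<Sum>j\<in>V-{i}. avg V (\<lambda>h. tilt \<delta> h i * tilt \<delta> h j)) =
      (\<Sum>i\<in>V. \<Sum>j\<in>V. if i = j then 0 else avg V (\<lambda>h. tilt \<delta> h i * tilt \<delta> h j))"
    by (intro sum.cong refl off)
  also have "\<dots> \<le> (\<Sum>i\<in>V. \<Sum>j\<in>V. \<delta>^2/4 * (?q i j / (sqrt (deg i) * sqrt (deg j)))
       - \<delta>/4 * (adj E i j * ?g i j) - \<delta>/4 * (adj E i j * ?g j i))"
  proof (intro sum_mono)
    fix i j assume ij: "i \<in> V" "j \<in> V"
    show "(if i = j then 0 else avg V (\<lambda>h. tilt \<delta> h i * tilt \<delta> h j)) \<le>
      \<delta>^2/4 * (?q i j / (sqrt (deg i) * sqrt (deg j)))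
       - \<delta>/4 * (adj E i j * ?g i j) - \<delta>/4 * (adj E i j * ?g j i)"
      using avg_tilt_mult_le[of i j \<delta>] g[of i j] g[of j i] ij
      by (cases "i = j") (auto simp: adj_self adj_commute[of E j i] diff_divide_distrib)
  qed
  also have "\<dots> = \<delta>^2/4 * ?Q - \<delta>/4 * ?R - \<delta>/4 * ?R"
    by (simp only: sum_subtractf sum_distrib_left[symmetric] sum_sign_clip)
  also have "\<dots> \<le> \<delta>^2/4 * ?Q" using R \<delta> by simp
  also have "\<dots> \<le> \<delta>^2/4 * (card V * (real D - 1))" using Q by (intro mult_left_mono) auto
  also have "\<dots> \<le> 1 * (card V * (real D - 1))"
  proof (intro mult_right_mono)
    have "\<delta>^2 \<le> 1" using \<delta> by (intro power_le_one) auto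
    then show "\<delta>^2/4 \<le> 1" by simp
  qed (use D(1) in auto)
  finally show ?thesis by simp
qed

section \<open>From tilted signs to a bisection: rounding and balancing\<close>

lemma bisection_of_sparse_neighborhoods:
  assumes \<delta>: "0 \<le> \<delta>" "\<delta> \<le> 1/2" "\<delta> * \<epsilon> \<le> 1/8"
    and sparse: "\<And>i. i \<in> V \<Longrightarrow> card (induced_edges E (N i)) \<le> \<epsilon> * real (deg i) powr (3/2)"
    and D: "D \<ge> 1" "\<And>k. k \<in> V \<Longrightarrow> deg k \<le> D" and ne: "V \<noteq> {}"
  shows "\<exists>A B. bisection V A B \<and> real (card (cut_edges E A B)) \<ge>
    real (card E) / 2 + \<delta> / 64 * (\<Sum>i\<in>V. sqrt (deg i)) - 2 * real (card E) * sqrt (real D / card V)"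
proof -
  let ?n = "real (card V)" and ?m = "real (card E)" and ?D = "\<Sum>i\<in>V. sqrt (deg i)"
  have n: "?n > 0" using ne finite_V by (simp add: card_gt_0_iff)
  define L where "L = sqrt (D * ?n)"
  have L: "L > 0" "L^2 = D * ?n" using n D(1) by (simp_all add: L_def)
  \<comment> \<open>The weight for which \<open>2 * \<bar>s\<bar> * L \<le> s^2 + L^2\<close> bounds
    the balancing loss by \<open>\<mu> * (s^2 + L^2)\<close>.\<close>
  define \<mu> where "\<mu> = ?m / (?n * L)"
  have \<mu>: "\<mu> \<ge> 0" using n L by (simp add: \<mu>_def)
  let ?w = "\<lambda>i j. adj E i j / 4 + \<mu>"
  \<comment> \<open>For signs, \<open>?F\<close> is \<open>?m / 2\<close> minus the cut, plus
    \<open>\<mu>\<close> times the off-diagonal part of the squared imbalance.\<close>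
  let ?F = "\<lambda>y. \<Sum>i\<in>V. \<Sum>j\<in>V-{i}. ?w i j * (y i * y j)"
  have F: "?F y = (\<Sum>i\<in>V. \<Sum>j\<in>V. adj E i j * (y i * y j)) / 4 + \<mu> * (\<Sum>i\<in>V. \<Sum>j\<in>V-{i}. y i * y j)"
    for y :: "'a \<Rightarrow> real"
  proof -
    have "(\<Sum>j\<in>V-{i}. adj E i j * (y i * y j)) = (\<Sum>j\<in>V. adj E i j * (y i * y j))" if "i \<in> V" for i
      using finite_V that by (simp add: sum.remove adj_self)
    then show ?thesis
      by (simp add: distrib_right sum.distrib sum_distrib_left sum_divide_distrib[symmetric])
  qed
  have "avg V (\<lambda>h. ?F (tilt \<delta> h)) =
      (\<Sum>i\<in>V. \<Sum>j\<in>V. adj E i j * avg V (\<lambda>h. tilt \<delta> h i * tilt \<delta> h j)) / 4 +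
      \<mu> * (\<Sum>i\<in>V. \<Sum>j\<in>V-{i}. avg V (\<lambda>h. tilt \<delta> h i * tilt \<delta> h j))"
  proof -
    have "avg V (\<lambda>h. ?F (tilt \<delta> h)) = avg V (\<lambda>h. (1/4) * (\<Sum>i\<in>V. \<Sum>j\<in>V. adj E i j * (tilt \<delta> h i * tilt \<delta> h j))
        + \<mu> * (\<Sum>i\<in>V. \<Sum>j\<in>V-{i}. tilt \<delta> h i * tilt \<delta> h j))"
      by (simp only: F) simp
    also have "\<dots> = (1/4) * (\<Sum>i\<in>V. \<Sum>j\<in>V. adj E i j * avg V (\<lambda>h. tilt \<delta> h i * tilt \<delta> h j))
        + \<mu> * (\<Sum>i\<in>V. \<Sum>j\<in>V-{i}. avg V (\<lambda>h. tilt \<delta> h i * tilt \<delta> h j))"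
      by (simp only: avg_add avg_cmult avg_sum)
    finally show ?thesis by simp
  qed
  also have "\<dots> \<le> (- \<delta> / 16 * ?D) / 4 + \<mu> * (?n * (real D - 1))"
    using \<mu> by (intro add_mono divide_right_mono mult_left_mono edge_correlation[where \<epsilon> = \<epsilon>] total_correlation assms) auto
  finally have avg: "avg V (\<lambda>h. ?F (tilt \<delta> h)) \<le> - \<delta> / 64 * ?D + \<mu> * (?n * (real D - 1))" by simp
  obtain S where S: "?F (tilt \<delta> (sign_of S)) \<le> avg V (\<lambda>h. ?F (tilt \<delta> h))"
    using ex_le_avg[OF finite_V, of "\<lambda>h. ?F (tilt \<delta> h)"] by blast
  obtain \<sigma> where \<sigma>: "\<forall>i\<in>V. \<bar>\<sigma> i\<bar> = 1" "?F \<sigma> \<le> ?F (tilt \<delta> (sign_of S))"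
    using off_diagonal_rounding[OF finite_V, of "tilt \<delta> (sign_of S)" ?w] abs_tilt_le[OF \<delta>(1,2)] by blast
  define A where "A = {i \<in> V. \<sigma> i = 1}"
  define B where "B = {i \<in> V. \<sigma> i \<noteq> 1}"
  let ?s = "\<Sum>i\<in>V. \<sigma> i"
  have cut: "real (card (cut_edges E A B)) = ?m / 2 - (\<Sum>i\<in>V. \<Sum>j\<in>V. adj E i j * (\<sigma> i * \<sigma> j)) / 4"
    and disc: "real (card A) - real (card B) = ?s"
    using cut_of_signs[of \<sigma>] \<sigma>(1) unfolding A_def B_def by auto
  obtain A' B' where AB: "bisection V A' B'"
    "real (card (cut_edges E A' B')) \<ge> real (card (cut_edges E A B)) - 2 * ?m / ?n * \<bar>?s\<bar>"
    using balance_cut[of A B] ne disc by (auto simp: A_def B_def)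
  \<comment> \<open>The diagonal left out of \<open>?F\<close> is constant on signs and contributes
    exactly \<open>?n\<close>.\<close>
  have sq: "?s^2 = ?n + (\<Sum>i\<in>V. \<Sum>j\<in>V-{i}. \<sigma> i * \<sigma> j)"
  proof -
    have one: "\<sigma> i * \<sigma> i = 1" if "i \<in> V" for i
      using \<sigma>(1) that abs_mult_self_eq[of "\<sigma> i"] by simp
    have "?s^2 = (\<Sum>i\<in>V. \<Sum>j\<in>V. \<sigma> i * \<sigma> j)" by (simp add: power2_eq_square sum_product)
    also have "\<dots> = (\<Sum>i\<in>V. 1 + (\<Sum>j\<in>V-{i}. \<sigma> i * \<sigma> j))"
      using finite_V by (intro sum.cong refl) (simp add: sum.remove one)
    finally show ?thesis by (simp add: sum.distrib)
  qed
  have "2 * ?m / ?n * \<bar>?s\<bar> = \<mu> * (2 * \<bar>?s\<bar> * L)" using L by (simp add: \<mu>_def)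
  also have "\<dots> \<le> \<mu> * (?s^2 + L^2)"
    using \<mu> sum_squares_bound[of "\<bar>?s\<bar>" L] by (intro mult_left_mono) auto
  finally have loss: "2 * ?m / ?n * \<bar>?s\<bar> \<le> \<mu> * ?s^2 + \<mu> * (D * ?n)" by (simp add: L(2) distrib_left)
  have "\<mu> * (D * ?n) = ?m * (L / ?n)"
    using L n unfolding L(2)[symmetric] \<mu>_def by (simp add: power2_eq_square)
  also have "L / ?n = sqrt (D / ?n)"
    using n by (simp add: L_def real_sqrt_mult real_sqrt_divide real_div_sqrt field_simps)
  finally have scale: "\<mu> * (D * ?n) = ?m * sqrt (D / ?n)" .
  have "?m / 2 - ?F \<sigma> - \<mu> * ?n - \<mu> * (D * ?n) \<le> real (card (cut_edges E A' B'))"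
    using AB(2) loss unfolding cut F sq by (simp add: algebra_simps)
  \<comment> \<open>The term \<open>- \<mu> * ?n\<close>, from the -1 in
    \<open>total_correlation\<close>, cancels the diagonal. What remains is twice
    \<open>\<mu> * (D * ?n)\<close>, which is the stated error term.\<close>
  moreover have "?F \<sigma> \<le> - \<delta> / 64 * ?D + \<mu> * (D * ?n) - \<mu> * ?n"
    using \<sigma>(2) S avg by (simp add: algebra_simps)
  ultimately have "?m / 2 + \<delta> / 64 * ?D - 2 * ?m * sqrt (D / ?n) \<le> real (card (cut_edges E A' B'))"
    using scale by linarith
  then show ?thesis using AB(1) by blast
qed

end

theorem theorem1p7:
  fixes \<epsilon> :: real
  assumes "\<epsilon> > 0"
  shows "\<exists>c::real. c > 0 \<and>
    (\<forall>(n::nat) (E :: nat set set).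
       n \<ge> 1 \<longrightarrow> simple_graph {1..n} E \<longrightarrow>
       (\<forall>i\<in>{1..n}. real (card (induced_edges E (neighborhood E i)))
                      \<le> \<epsilon> * real (vertex_degree E i) powr (3/2)) \<longrightarrow>
       (\<exists>A B. bisection {1..n} A B \<and>
          real (card (cut_edges E A B)) \<ge>
            real (card E) / 2 + c * (\<Sum>i=1..n. sqrt (real (vertex_degree E i)))
            - 2 * real (card E) * sqrt (real (max_degree {1..n} E) / real n)))"
proof -
  \<comment> \<open>The first bound keeps tilted signs in [-1, 1]; the second gives
    \<open>\<delta> * \<epsilon> \<le> 1/8\<close>.\<close>
  define \<delta> where "\<delta> = min (1/2) (1 / (8 * \<epsilon>))"
  have \<delta>: "\<delta> > 0" "\<delta> \<le> 1/2" using assms by (auto simp: \<delta>_def)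
  have "\<delta> * \<epsilon> \<le> 1 / (8 * \<epsilon>) * \<epsilon>" using assms by (intro mult_right_mono) (auto simp: \<delta>_def)
  then have \<delta>\<epsilon>: "\<delta> * \<epsilon> \<le> 1/8" using assms by simp
  show ?thesis
  proof (intro exI[of _ "\<delta>/64"] conjI allI impI)
    fix n :: nat and E :: "nat set set"
    assume n: "n \<ge> 1" and G: "simple_graph {1..n} E"
      and sparse: "\<forall>i\<in>{1..n}. real (card (induced_edges E (neighborhood E i)))
                      \<le> \<epsilon> * real (vertex_degree E i) powr (3/2)"
    interpret sgraph "{1..n}" E using G by unfold_locales
    have max: "deg k \<le> max_degree {1..n} E" if "k \<in> {1..n}" for k
      unfolding max_degree_def using that by (intro Max_ge) auto
    have ne: "{1..n} \<noteq> {}" using n by simp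
    show "\<exists>A B. bisection {1..n} A B \<and>
          real (card (cut_edges E A B)) \<ge>
            real (card E) / 2 + \<delta>/64 * (\<Sum>i=1..n. sqrt (real (vertex_degree E i)))
            - 2 * real (card E) * sqrt (real (max_degree {1..n} E) / real n)"
    proof (cases "max_degree {1..n} E \<ge> 1")
      case True
      then show ?thesis
        using bisection_of_sparse_neighborhoods[of \<delta> \<epsilon> "max_degree {1..n} E"] \<delta> \<delta>\<epsilon> sparse max ne by simp
    next
      case False
      \<comment> \<open>Maximum degree 0: there are no edges and the required size is 0, so any
        bisection works; balancing the trivial partition provides one.\<close>
      then have deg0: "deg k = 0" if "k \<in> {1..n}" for k using max[OF that] by simp
      then have "real (card E) = 0" using sum_deg by simp
      moreover obtain A B where "bisection {1..n} A B"
        using balance_cut[of "{1..n}" "{}"] ne by auto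
      ultimately show ?thesis using deg0 by (intro exI[of _ A] exI[of _ B]) simp
    qed
  qed (use \<delta> in simp)
qed

end
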